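(* Let $F\in C^\infty(\overline{\Omega_r})$ be such that for every $s$ the restriction of $F$ to the circle $C_s=\{x:|x-\gamma(s)|=r\}$ coincides with the restriction to $C_s$ of a polynomial in two variables of degree at most $N$. Then $F$ is a polynomial function in the variables $(x_1,x_2)$ of degree at most $2N$.
   Context: $\gamma$ is a smooth simple closed curve in $\mathbb{R}^2$ parametrized by arc length $s$, $n=J\dot\gamma$ with $J$ the counterclockwise rotation by $\pi/2$, and $\gamma_t=\gamma+t\,n$ is the parallel curve. $r_0$ is the largest radius for which the tubular neighbourhood of $\gamma$ is diffeomorphic to its normal bundle, and $r>0$ satisfies $r<r_0/2$. $\Omega_r$ is the annulus bounded by $\gamma_{+r}$ and $\gamma_{-r}$, i.e. the set of centers of circles of radius $r$ intersecting $\gamma$; $\overline{\Omega_r}$ is the union of the circles $C_s$. *)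

theory Defs
  imports "HOL-Analysis.Analysis"
begin

definition smooth_curve :: "(real \<Rightarrow> 'a::real_normed_vector) \<Rightarrow> bool" where
  "smooth_curve g \<longleftrightarrow> (\<exists>D::nat \<Rightarrow> real \<Rightarrow> 'a. D 0 = g \<and>
      (\<forall>k t. (D k has_vector_derivative D (Suc k) t) (at t)))"

definition rotJ :: "real^2 \<Rightarrow> real^2" where
  "rotJ v = vector [- (v$2), v$1]"

definition unit_normal :: "(real \<Rightarrow> real^2) \<Rightarrow> real \<Rightarrow> real^2" where
  "unit_normal g s = rotJ (vector_derivative g (at s))"

definition arclength_simple_closed :: "(real \<Rightarrow> real^2) \<Rightarrow> real \<Rightarrow> bool" where
  "arclength_simple_closed g L \<longleftrightarrow> L > 0 \<and> smooth_curve g \<and>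
     (\<forall>s. g (s + L) = g s) \<and> inj_on g {0..<L} \<and>
     (\<forall>s. norm (vector_derivative g (at s)) = 1)"

definition normal_map :: "(real \<Rightarrow> real^2) \<Rightarrow> real \<times> real \<Rightarrow> real^2" where
  "normal_map g = (\<lambda>(s,t). g s + t *\<^sub>R unit_normal g s)"

text \<open>The normal map restricted to the normal band of radius rho is a diffeomorphism
  onto its image (injective modulo the period, with invertible differential).
  r0 is the supremum of such rho.\<close>
definition tubular_radius_ok :: "(real \<Rightarrow> real^2) \<Rightarrow> real \<Rightarrow> real \<Rightarrow> bool" where
  "tubular_radius_ok g L \<rho> \<longleftrightarrow> \<rho> > 0 \<and>
     inj_on (normal_map g) ({0..<L} \<times> {-\<rho><..<\<rho>}) \<and>
     (\<forall>s t. \<bar>t\<bar> < \<rho> \<longrightarrow>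
        (\<exists>D. (normal_map g has_derivative D) (at (s,t)) \<and> bij D))"

definition tubular_r0 :: "(real \<Rightarrow> real^2) \<Rightarrow> real \<Rightarrow> ereal" where
  "tubular_r0 g L = Sup {ereal \<rho> | \<rho>. tubular_radius_ok g L \<rho>}"

definition Omega_bar :: "(real \<Rightarrow> real^2) \<Rightarrow> real \<Rightarrow> (real^2) set" where
  "Omega_bar g r = {x. \<exists>s. dist x (g s) = r}"

definition poly2_deg_le :: "nat \<Rightarrow> (real^2 \<Rightarrow> real) \<Rightarrow> bool" where
  "poly2_deg_le N P \<longleftrightarrow> (\<exists>c::nat \<Rightarrow> nat \<Rightarrow> real.
      \<forall>x. P x = (\<Sum>i\<le>N. \<Sum>j\<le>N - i. c i j * (x$1) ^ i * (x$2) ^ j))"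

text \<open>C-infinity functions on an open set U: all iterated partial derivatives exist
  and are continuous on U.  D l is the partial derivative along the list l of
  coordinate directions (applied from the right).\<close>
definition smooth_on_open :: "(real^2) set \<Rightarrow> (real^2 \<Rightarrow> real) \<Rightarrow> bool" where
  "smooth_on_open U f \<longleftrightarrow> open U \<and> (\<exists>D::2 list \<Rightarrow> real^2 \<Rightarrow> real.
      (\<forall>x\<in>U. D [] x = f x) \<and>
      (\<forall>l. continuous_on U (D l)) \<and>
      (\<forall>l i x. x \<in> U \<longrightarrow>
         ((\<lambda>h. D l (x + h *\<^sub>R axis i 1)) has_real_derivative D (i # l) x) (at 0)))"

definition smooth_on_set :: "(real^2) set \<Rightarrow> (real^2 \<Rightarrow> real) \<Rightarrow> bool" where
  "smooth_on_set S f \<longleftrightarrow> (\<exists>U G. S \<subseteq> U \<and> smooth_on_open U G \<and> (\<forall>x\<in>S. G x = f x))"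

end

theory Submission
  imports Defs
begin

text \<open>
  Call the spectrum of a function on a circle the set of its Fourier frequencies. If \<open>F\<close> has
  spectrum in \<open>[-m, n]\<close> on every circle \<open>C\<^sub>s\<close>, then so do its derivatives along the circle and
  along \<open>\<gamma>'(s)\<close> (translate the circle). With \<open>z = e\<^sup>i\<^sup>\<theta>\<close> and \<open>g = \<gamma>'(s)\<close> as a complex number,
  these derivatives are \<open>g \<partial>F + g\<^sup>* \<partial>\<^sup>*F\<close> and \<open>ir (z \<partial>F - z\<^sup>* \<partial>\<^sup>*F)\<close>, where \<open>\<partial>\<close> and
  \<open>\<partial>\<^sup>*\<close> are the Wirtinger operators. Eliminating one of the two unknowns shows that
  \<open>(g + g\<^sup>* z\<^sup>2) \<partial>F\<close> and \<open>(g + g\<^sup>* z\<^sup>2) \<partial>\<^sup>*F\<close> are Laurent polynomials in \<open>z\<close>; the zeros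
  \<open>\<plusminus>ig\<close> of the quadratic lie on the unit circle, so it divides them. The degree count gives
  \<open>[-m, n - 1]\<close> for \<open>\<partial>F\<close> and \<open>[-m + 1, n]\<close> for \<open>\<partial>\<^sup>*F\<close>. Starting from \<open>[-N, N]\<close>, every
  derivative of order \<open>2N + 1\<close> has empty spectrum, that is, it vanishes on all circles. Hence the
  gradient in \<open>x\<close> of the Taylor polynomial of degree \<open>2N\<close> centred at \<open>x\<close> vanishes on the
  circles, so this polynomial does not depend on \<open>x\<close>; at \<open>x\<close> its value is \<open>F(x)\<close>.
\<close>

subsection \<open>Polynomials on the unit circle\<close>

text \<open>\<open>d\<close> counts the admissible coefficients. Unlike a bound on
  \<open>degree\<close>, the strict bound has the case \<open>d = 0\<close>, which forces
  \<open>p = 0\<close>; the descent on the spectrum ends there.\<close>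

definition deg_below :: "nat \<Rightarrow> 'a::zero poly \<Rightarrow> bool" where
  "deg_below d p \<longleftrightarrow> (\<forall>k\<ge>d. coeff p k = 0)"

lemma deg_below_iff: "deg_below d p \<longleftrightarrow> p = 0 \<or> degree p < d"
proof
  assume "deg_below d p"
  thus "p = 0 \<or> degree p < d"
    unfolding deg_below_def using leading_coeff_0_iff[of p] by (meson not_le)
next
  assume "p = 0 \<or> degree p < d"
  thus "deg_below d p" by (auto simp: deg_below_def intro: coeff_eq_0)
qed

lemma deg_below_SucI: "degree p \<le> d \<Longrightarrow> deg_below (Suc d) p"
  by (simp add: deg_below_iff)

lemma deg_below_add: "deg_below d p \<Longrightarrow> deg_below d q \<Longrightarrow> deg_below d (p + q)"
  for p q :: "'a::comm_monoid_add poly"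
  by (simp add: deg_below_def)

lemma deg_below_diff: "deg_below d p \<Longrightarrow> deg_below d q \<Longrightarrow> deg_below d (p - q)"
  for p q :: "'a::ab_group_add poly"
  by (simp add: deg_below_def)

lemma deg_below_smult: "deg_below d p \<Longrightarrow> deg_below d (smult c p)"
  for p :: "'a::comm_semiring_0 poly"
  by (simp add: deg_below_def)

lemma deg_below_sum: "(\<And>a. a \<in> A \<Longrightarrow> deg_below d (f a)) \<Longrightarrow> deg_below d (sum f A)"
  for f :: "'b \<Rightarrow> 'a::comm_monoid_add poly"
  by (simp add: deg_below_def coeff_sum)

lemma deg_below_pCons: "deg_below d p \<Longrightarrow> deg_below (Suc d) (pCons c p)"
  by (auto simp: deg_below_def coeff_pCons split: nat.split)

lemma deg_below_Suc: "deg_below d p \<Longrightarrow> deg_below (Suc d) p"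
  by (simp add: deg_below_def)

lemma deg_below_pCons_pderiv: "deg_below d p \<Longrightarrow> deg_below d (pCons 0 (pderiv p))"
  for p :: "'a::{comm_semiring_1,semiring_no_zero_divisors} poly"
  by (auto simp: deg_below_def coeff_pCons coeff_pderiv split: nat.split)

text \<open>Lagrange interpolation at the \<open>d\<close>-th roots of unity. Nodes and basis
  polynomials do not depend on \<open>p\<close>, so a family of polynomials depending on a parameter
  is controlled by finitely many values on the circle.\<close>

lemma unit_circle_interpolation:
  obtains A :: "complex set" and l :: "complex \<Rightarrow> complex poly"
  where "finite A" "\<And>a. a \<in> A \<Longrightarrow> norm a = 1" "\<And>a. a \<in> A \<Longrightarrow> deg_below d (l a)"
    "\<And>p z. deg_below d p \<Longrightarrow> poly p z = (\<Sum>a\<in>A. poly p a * poly (l a) z)"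
proof (cases "d = 0")
  case True
  show ?thesis by (rule that[of "{}"]) (auto simp: True deg_below_iff)
next
  case False
  define A where "A = {z::complex. z ^ d = 1}"
  have card: "card A = d" unfolding A_def using False by (intro card_roots_unity_eq) auto
  have fin: "finite A" using card False card.infinite by fastforce
  have nrm: "norm a = 1" if "a \<in> A" for a
  proof -
    have "norm a ^ d = 1" using that by (simp add: A_def flip: norm_power)
    thus ?thesis using False power_eq_imp_eq_base[of "norm a" d 1] by simp
  qed
  define l where "l a = (\<Prod>b\<in>A-{a}. smult (inverse (a - b)) [:-b, 1:])" for a
  have deg: "deg_below d (l a)" if "a \<in> A" for a
  proof -
    have "degree (l a) \<le> (\<Sum>b\<in>A-{a}. degree (smult (inverse (a - b)) [:-b, 1:]))"
      unfolding l_def using fin degree_prod_sum_le[of "A - {a}" "\<lambda>b. smult (inverse (a - b)) [:-b, 1:]"]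
      by (simp add: o_def)
    also have "\<dots> \<le> (\<Sum>b\<in>A-{a}. 1)" by (intro sum_mono) auto
    also have "\<dots> < d" using card fin that False by simp
    finally show ?thesis by (simp add: deg_below_iff)
  qed
  have la: "poly (l a) b = (if b = a then 1 else 0)" if "a \<in> A" "b \<in> A" for a b
  proof (cases "b = a")
    case True
    have "poly (smult (inverse (a - x)) [:-x, 1:]) a = 1" if "x \<noteq> a" for x
      using left_inverse[of "a - x"] that by (simp add: algebra_simps)
    thus ?thesis unfolding l_def poly_prod True by (auto intro!: prod.neutral)
  next
    case False
    thus ?thesis unfolding l_def poly_prod using that fin by auto
  qed
  have "poly p z = (\<Sum>a\<in>A. poly p a * poly (l a) z)" if p: "deg_below d p" for p z
  proof -
    \<comment> \<open>The interpolation error has degree below \<open>d\<close> and vanishes at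
      \<open>d\<close> distinct nodes, hence is zero.\<close>
    define q where "q = p - (\<Sum>a\<in>A. smult (poly p a) (l a))"
    have q: "deg_below d q"
      unfolding q_def by (intro deg_below_diff p deg_below_sum deg_below_smult deg)
    have "poly q b = 0" if "b \<in> A" for b
    proof -
      have "(\<Sum>a\<in>A. poly p a * poly (l a) b) = (\<Sum>a\<in>A. if b = a then poly p a else 0)"
        by (intro sum.cong) (auto simp: la that)
      thus ?thesis using that fin by (simp add: q_def poly_sum)
    qed
    hence sub: "A \<subseteq> {x. poly q x = 0}" by auto
    have "q = 0"
    proof (rule ccontr)
      assume "q \<noteq> 0"
      hence "d \<le> degree q"
        using card_mono[OF poly_roots_finite sub] card_poly_roots_bound[of q] card by simp
      thus False using q \<open>q \<noteq> 0\<close> by (simp add: deg_below_iff)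
    qed
    hence "p = (\<Sum>a\<in>A. smult (poly p a) (l a))" by (simp add: q_def)
    from arg_cong[OF this, of "\<lambda>p. poly p z"] show ?thesis by (simp add: poly_sum)
  qed
  with fin nrm deg show ?thesis by (rule that)
qed

text \<open>As g has norm 1, the quadratic is cnj g (z - ig)(z + ig) with both zeros on the unit
  circle, so \<open>zero\<close> makes both linear factors divide \<open>a\<close>. If
  \<open>d \<le> 1\<close>, two distinct zeros force \<open>a = 0\<close>, in agreement with the
  truncated \<open>d - 1\<close>.\<close>

lemma quadratic_factor:
  fixes g :: complex
  assumes g: "norm g = 1" and a: "deg_below (Suc d) a"
    and zero: "\<And>z. g + cnj g * z\<^sup>2 = 0 \<Longrightarrow> norm z = 1 \<Longrightarrow> poly a z = 0"
  obtains b where "deg_below (d - 1) b" "\<And>z. poly a z = (g + cnj g * z\<^sup>2) * poly b z"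
proof -
  have gg: "g * cnj g = 1" using g complex_norm_square[of g] by simp
  have g0: "g \<noteq> 0" using g by auto
  have "g + cnj g * (\<i> * g)\<^sup>2 = g - (g * cnj g) * g"
    by (simp add: power2_eq_square algebra_simps)
  hence n: "g + cnj g * (\<i> * g)\<^sup>2 = 0" by (simp add: gg)
  have r1: "poly a (\<i> * g) = 0" using zero[OF n] g by (simp add: norm_mult)
  have r2: "poly a (- \<i> * g) = 0" using zero[of "-\<i> * g"] n g by (simp add: norm_mult)
  obtain b1 where b1: "a = [:- (\<i> * g), 1:] * b1" using r1 by (auto simp: poly_eq_0_iff_dvd)
  have "poly b1 (-\<i> * g) = 0" using r2 g0 by (simp add: b1)
  then obtain b2 where b2: "b1 = [:\<i> * g, 1:] * b2" by (auto simp: poly_eq_0_iff_dvd)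
  \<comment> \<open>The factor \<open>g\<close> in the quotient compensates the leading coefficient
    \<open>cnj g\<close>, because \<open>g * cnj g = 1\<close>.\<close>
  have "poly a z = (g + cnj g * z\<^sup>2) * poly (smult g b2) z" for z
  proof -
    have "(g + cnj g * z\<^sup>2) * g = g\<^sup>2 + (g * cnj g) * z\<^sup>2" by (simp add: algebra_simps power2_eq_square)
    also have "\<dots> = (z - \<i> * g) * (z + \<i> * g)"
      unfolding gg by (simp add: algebra_simps power2_eq_square)
    finally show ?thesis by (simp add: b1 b2 algebra_simps)
  qed
  moreover have "deg_below (d - 1) (smult g b2)"
  proof (cases "b2 = 0")
    case False
    have lin: "degree ([:c, 1:] * q) = Suc (degree q)" if "q \<noteq> 0" for c :: complex and q
      using degree_mult_eq[of "[:c, 1:]" q] that by (simp del: mult_pCons_left)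
    have "b1 \<noteq> 0" using False unfolding b2 by (simp del: mult_pCons_left)
    moreover have "degree b1 = Suc (degree b2)" unfolding b2 by (rule lin) fact
    moreover have "degree a = Suc (degree b1)" unfolding b1 by (rule lin) fact
    ultimately have "degree a = 2 + degree b2" by simp
    moreover have "a \<noteq> 0" using False unfolding b1 b2 by (simp del: mult_pCons_left)
    ultimately have "degree b2 < d - 1" using a by (auto simp: deg_below_iff)
    thus ?thesis by (intro deg_below_smult) (simp add: deg_below_iff)
  qed (simp add: deg_below_iff)
  ultimately show ?thesis using that by blast
qed

subsection \<open>Jets and circles\<close>

lemma vec2_eq: "x = (x$1) *\<^sub>R axis 1 1 + (x$2) *\<^sub>R axis 2 (1::real)" for x :: "real^2"
  by (simp add: vec_eq_iff forall_2 axis_def)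

lemma norm_vec2_le: "norm x \<le> \<bar>x$1\<bar> + \<bar>x$2\<bar>" for x :: "real^2"
  using norm_le_l1_cart[of x] by (simp add: sum_2)

text \<open>Only the second partial derivative has to exist near \<open>x\<close> and be continuous.
  \<open>has_derivative_partialsI\<close> gives this on the product of two lines; \<open>V\<close>
  carries it over to \<open>real^2\<close>.\<close>

lemma has_derivative_vec2I:
  fixes f f1 f2 :: "real^2 \<Rightarrow> real"
  assumes U: "open U" "x \<in> U"
    and f1: "((\<lambda>h. f (x + h *\<^sub>R axis 1 1)) has_real_derivative f1 x) (at 0)"
    and f2: "\<And>x. x \<in> U \<Longrightarrow> ((\<lambda>h. f (x + h *\<^sub>R axis 2 1)) has_real_derivative f2 x) (at 0)"
    and cont: "continuous_on U f2"
  shows "(f has_derivative (\<lambda>v. v$1 * f1 x + v$2 * f2 x)) (at x)"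
proof -
  obtain e where e: "e > 0" "ball x e \<subseteq> U" using U openE by blast
  define V :: "real \<Rightarrow> real \<Rightarrow> real^2" where "V a b = a *\<^sub>R axis 1 1 + b *\<^sub>R axis 2 1" for a b
  have V[simp]: "V a b $ 1 = a" "V a b $ 2 = b" for a b by (simp_all add: V_def axis_def)
  have Vx: "V (y$1) (y$2) = y" for y by (simp add: V_def flip: vec2_eq)
  \<comment> \<open>Half of \<open>e\<close> on each side suffices, since the norm is at most the
    sum of the coordinate moduli.\<close>
  define X Y where "X = ball (x$1) (e/2)" and "Y = ball (x$2) (e/2)"
  have inU: "V a b \<in> U" if "a \<in> X" "b \<in> Y" for a b
  proof -
    have "norm (x - V a b) < e"
      using norm_vec2_le[of "x - V a b"] that by (simp add: X_def Y_def dist_real_def)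
    thus ?thesis using e by (auto simp: dist_norm)
  qed
  have xy: "x$1 \<in> X" "x$2 \<in> Y" using e by (auto simp: X_def Y_def)
  have d1: "((\<lambda>a. f (V a (x$2))) has_derivative (\<lambda>t. f1 x * t)) (at (x$1) within X)"
  proof -
    have "(\<lambda>h. f (x + h *\<^sub>R axis 1 1)) = (\<lambda>h. f (V (h + x$1) (x$2)))"
      by (subst (1) Vx[symmetric]) (simp add: V_def algebra_simps)
    hence "((\<lambda>a. f (V a (x$2))) has_real_derivative f1 x) (at (0 + x$1))"
      using f1 by (subst DERIV_shift) simp
    thus ?thesis by (simp add: has_field_derivative_def has_derivative_at_withinI)
  qed
  have d2: "((\<lambda>b. f (V a b)) has_derivative blinfun_apply (blinfun_mult_right (f2 (V a b)))) (at b within Y)"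
    if "a \<in> X" "b \<in> Y" for a b
  proof -
    have "(\<lambda>h. f (V a b + h *\<^sub>R axis 2 1)) = (\<lambda>h. f (V a (h + b)))"
      by (simp add: V_def algebra_simps)
    hence "((\<lambda>b. f (V a b)) has_real_derivative f2 (V a b)) (at (0 + b))"
      using f2[OF inU[OF that]] by (subst DERIV_shift) simp
    thus ?thesis by (simp add: has_field_derivative_def has_derivative_at_withinI)
  qed
  have "continuous_on (X \<times> Y) (\<lambda>p. f2 (V (fst p) (snd p)))"
    by (rule continuous_on_compose2[OF cont])
      (unfold V_def, auto simp: inU[unfolded V_def] intro!: continuous_intros)
  hence "continuous_on (X \<times> Y) (\<lambda>p. blinfun_mult_right (f2 (V (fst p) (snd p))))"
    by (rule bounded_linear.continuous_on[OF bounded_linear_blinfun_mult_right])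
  hence c2: "continuous (at (x$1, x$2) within X \<times> Y) (\<lambda>(a,b). blinfun_mult_right (f2 (V a b)))"
    using xy by (simp add: continuous_on_eq_continuous_within case_prod_unfold)
  have "((\<lambda>(a,b). f (V a b)) has_derivative
      (\<lambda>(s,t). f1 x * s + blinfun_apply (blinfun_mult_right (f2 (V (x$1) (x$2)))) t))
      (at (x$1, x$2) within X \<times> Y)"
    by (rule has_derivative_partialsI[OF d1 d2 c2 xy(2)]) (auto simp: Y_def)
  moreover have "at (x$1, x$2) within X \<times> Y = at (x$1, x$2)"
    using xy by (intro at_within_open open_Times) (auto simp: X_def Y_def)
  ultimately have *: "((\<lambda>(a,b). f (V a b)) has_derivative (\<lambda>(s,t). f1 x * s + f2 x * t)) (at (x$1, x$2))"
    by (simp add: Vx)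
  have "((\<lambda>y::real^2. (y$1, y$2)) has_derivative (\<lambda>y. (y$1, y$2))) (at x)"
    by (intro bounded_linear_imp_has_derivative bounded_linear_Pair bounded_linear_vec_nth)
  from has_derivative_compose[OF this *] show ?thesis
    by (simp add: Vx mult.commute)
qed

text \<open>Total derivatives replace the partial ones of \<open>smooth_on_open\<close>, so the
  chain rule applies along any curve. The head of the list is the derivative taken last. The general
  codomain admits both the real jet and its complexification.\<close>

definition jet_on :: "(real^2) set \<Rightarrow> (2 list \<Rightarrow> real^2 \<Rightarrow> 'a::real_normed_vector) \<Rightarrow> bool" where
  "jet_on U D \<longleftrightarrow> open U \<and> (\<forall>l. \<forall>x\<in>U.
     (D l has_derivative (\<lambda>v. (v$1) *\<^sub>R D (1 # l) x + (v$2) *\<^sub>R D (2 # l) x)) (at x))"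

lemma jet_onD:
  "jet_on U D \<Longrightarrow> x \<in> U \<Longrightarrow>
     (D l has_derivative (\<lambda>v. (v$1) *\<^sub>R D (1 # l) x + (v$2) *\<^sub>R D (2 # l) x)) (at x)"
  by (simp add: jet_on_def)

lemma smooth_on_openE:
  assumes "smooth_on_open U f"
  obtains D where "jet_on U D" "\<And>x. x \<in> U \<Longrightarrow> D [] x = f x"
proof -
  from assms obtain D where U: "open U" and D: "\<forall>x\<in>U. D [] x = f x"
    and c: "\<forall>l. continuous_on U (D l)"
    and d: "\<forall>l i x. x \<in> U \<longrightarrow>
         ((\<lambda>h. D l (x + h *\<^sub>R axis i 1)) has_real_derivative D (i # l) x) (at 0)"
    unfolding smooth_on_open_def by blast
  have "(D l has_derivative (\<lambda>v. v$1 * D (1 # l) x + v$2 * D (2 # l) x)) (at x)" if "x \<in> U" for l x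
    using U that d c by (intro has_derivative_vec2I[where U=U]) auto
  hence "jet_on U D" using U by (simp add: jet_on_def)
  thus ?thesis using D that by blast
qed

lemma jet_on_of_real:
  assumes "jet_on U D"
  shows "jet_on U (\<lambda>l x. of_real (D l x) :: 'a::real_normed_algebra_1)"
  unfolding jet_on_def
proof (intro conjI allI ballI)
  show "open U" using assms by (simp add: jet_on_def)
  fix l x assume "x \<in> U"
  from has_derivative_of_real[OF jet_onD[OF assms this, of l], where 'a='a]
  show "((\<lambda>x. of_real (D l x) :: 'a) has_derivative
      (\<lambda>v. (v$1) *\<^sub>R of_real (D (1 # l) x) + (v$2) *\<^sub>R of_real (D (2 # l) x))) (at x)"
    by (simp add: scaleR_conv_of_real)
qed

text \<open>The end of a list is the derivative taken first, so appending there yields the jet of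
  the function \<open>a * D [1] + b * D [2]\<close> without any symmetry of mixed partials.\<close>

lemma jet_on_first_order:
  fixes D :: "2 list \<Rightarrow> real^2 \<Rightarrow> 'a::real_normed_algebra"
  assumes "jet_on U D"
  shows "jet_on U (\<lambda>l x. a * D (l @ [1]) x + b * D (l @ [2]) x)"
  unfolding jet_on_def
proof (intro conjI allI ballI)
  show "open U" using assms by (simp add: jet_on_def)
  fix l x assume "x \<in> U"
  note j = jet_onD[OF assms this]
  show "((\<lambda>x. a * D (l @ [1]) x + b * D (l @ [2]) x) has_derivative
      (\<lambda>v. (v$1) *\<^sub>R (a * D ((1 # l) @ [1]) x + b * D ((1 # l) @ [2]) x)
         + (v$2) *\<^sub>R (a * D ((2 # l) @ [1]) x + b * D ((2 # l) @ [2]) x))) (at x)"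
    using has_derivative_add[OF has_derivative_mult_right[OF j[of "l @ [1]"], of a]
        has_derivative_mult_right[OF j[of "l @ [2]"], of b]]
    by (simp add: algebra_simps)
qed

section \<open>Circles in polar coordinates and motion along them\<close>

definition circle_pt :: "real^2 \<Rightarrow> real \<Rightarrow> real \<Rightarrow> real^2" where
  "circle_pt a r \<theta> = a + (r * cos \<theta>) *\<^sub>R axis 1 1 + (r * sin \<theta>) *\<^sub>R axis 2 1"

lemma circle_pt_nth [simp]:
  "circle_pt a r \<theta> $ 1 = a$1 + r * cos \<theta>" "circle_pt a r \<theta> $ 2 = a$2 + r * sin \<theta>"
  by (simp_all add: circle_pt_def axis_def)

lemma dist_circle_pt: "r \<ge> 0 \<Longrightarrow> dist (circle_pt a r \<theta>) a = r"
proof -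
  assume "r \<ge> 0"
  have "(r * cos \<theta>)\<^sup>2 + (r * sin \<theta>)\<^sup>2 = r\<^sup>2 * ((cos \<theta>)\<^sup>2 + (sin \<theta>)\<^sup>2)"
    by (simp only: power_mult_distrib distrib_left)
  with \<open>r \<ge> 0\<close> show ?thesis by (simp add: dist_norm norm_vec_def L2_set_def sum_2)
qed

lemma circle_pt_exhaust:
  assumes "dist x a = r"
  obtains \<theta> where "x = circle_pt a r \<theta>"
proof -
  define z where "z = Complex (x$1 - a$1) (x$2 - a$2)"
  have "norm z = r"
    using assms by (simp add: z_def cmod_def dist_norm norm_vec_def L2_set_def sum_2)
  hence z: "z = rcis r (Arg z)" using rcis_cmod_Arg[of z] by simp
  have "x$1 = a$1 + r * cos (Arg z)" "x$2 = a$2 + r * sin (Arg z)"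
    using arg_cong[OF z, of Re] arg_cong[OF z, of Im] by (simp_all add: z_def)
  hence "x = circle_pt a r (Arg z)" by (simp add: vec_eq_iff forall_2)
  thus ?thesis by (rule that)
qed

lemma has_vector_derivative_has_derivative_compose:
  assumes "(c has_vector_derivative c') (at t)" "(f has_derivative f') (at (c t))"
  shows "((\<lambda>t. f (c t)) has_vector_derivative f' c') (at t)"
  using vector_derivative_diff_chain_within[of c c' t UNIV f f'] assms
  by (simp add: o_def has_derivative_at_withinI)

lemma circle_pt_centre_derivative:
  assumes "(\<gamma> has_vector_derivative v) (at s)"
  shows "((\<lambda>s. circle_pt (\<gamma> s) r \<theta>) has_vector_derivative v) (at s)"
  unfolding circle_pt_def using assms by (auto intro!: derivative_eq_intros)

lemma circle_pt_angle_derivative: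
  "((\<lambda>\<theta>. circle_pt a r \<theta>) has_vector_derivative
     (- (r * sin \<theta>)) *\<^sub>R axis 1 1 + (r * cos \<theta>) *\<^sub>R axis 2 1) (at \<theta>)"
  unfolding circle_pt_def
  by (auto intro!: derivative_eq_intros simp: mult.commute)

text \<open>Two points are joined by moving the centre along the curve at a fixed angle and then
  turning the angle at a fixed centre; \<open>f\<close> is stationary all along.\<close>

lemma has_derivative_zero_on_circles_const:
  fixes f :: "real^2 \<Rightarrow> 'a::real_normed_vector" and \<gamma> :: "real \<Rightarrow> real^2"
  assumes \<gamma>: "\<And>s. \<gamma> differentiable at s"
    and f: "\<And>s \<theta>. (f has_derivative (\<lambda>_. 0)) (at (circle_pt (\<gamma> s) r \<theta>))"
  shows "f (circle_pt (\<gamma> s) r \<theta>) = f (circle_pt (\<gamma> s') r \<theta>')"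
proof -
  have 1: "((\<lambda>s. f (circle_pt (\<gamma> s) r \<theta>)) has_vector_derivative 0) (at s)" for s \<theta>
    by (rule has_vector_derivative_has_derivative_compose[OF circle_pt_centre_derivative f])
      (use \<gamma>[of s] in \<open>simp add: vector_derivative_works\<close>)
  have 2: "((\<lambda>\<theta>. f (circle_pt (\<gamma> s) r \<theta>)) has_vector_derivative 0) (at \<theta>)" for s \<theta>
    using has_vector_derivative_has_derivative_compose[OF circle_pt_angle_derivative f] .
  have const: "g a = g b" if "\<And>t. (g has_vector_derivative 0) (at t)" for g :: "real \<Rightarrow> 'a" and a b
  proof -
    have "\<exists>c. \<forall>x\<in>UNIV. g x = c"
      using that by (intro has_derivative_zero_constant) (auto simp: has_vector_derivative_def)
    thus ?thesis by auto
  qed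
  show ?thesis using const[OF 1[where \<theta>=\<theta>], of s s'] const[OF 2[where s=s'], of \<theta> \<theta>'] by simp
qed

subsection \<open>Symmetry of mixed partial derivatives\<close>

text \<open>The mean value theorem is applied first in direction \<open>i\<close> to a difference in
  direction \<open>k\<close>, then in direction \<open>k\<close>. The second difference is symmetric
  in \<open>i\<close> and \<open>k\<close>, whereas the right-hand side records their order.\<close>

lemma second_difference_mean_value:
  fixes D :: "2 list \<Rightarrow> real^2 \<Rightarrow> real" and i k :: 2
  assumes D: "jet_on U D" and h: "h > 0" and ball: "cball x (2 * h) \<subseteq> U"
  obtains y where "y \<in> cball x (2 * h)"
    "D l (x + h *\<^sub>R axis i 1 + h *\<^sub>R axis k 1) - D l (x + h *\<^sub>R axis i 1)
      - D l (x + h *\<^sub>R axis k 1) + D l x = h * h * D (k # i # l) y"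
proof -
  have part: "((\<lambda>t. D m (a + t *\<^sub>R axis j 1)) has_real_derivative D (j # m) (a + t *\<^sub>R axis j 1)) (at t)"
    if "a + t *\<^sub>R axis j 1 \<in> U" for m a j t
  proof -
    have "((\<lambda>t. a + t *\<^sub>R axis j (1::real)) has_vector_derivative axis j 1) (at t)"
      by (auto intro!: derivative_eq_intros)
    from has_vector_derivative_has_derivative_compose[OF this jet_onD[OF D that, of m]]
    show ?thesis using exhaust_2[of j]
      by (auto simp: has_real_derivative_iff_has_vector_derivative axis_def)
  qed
  have inU: "x + s *\<^sub>R axis i 1 + t *\<^sub>R axis k 1 \<in> cball x (2 * h)"
    if "0 \<le> s" "s \<le> h" "0 \<le> t" "t \<le> h" for s t
  proof -
    have "norm (s *\<^sub>R axis i (1::real) + t *\<^sub>R axis k 1) \<le> s + t"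
      using norm_triangle_ineq[of "s *\<^sub>R axis i (1::real)" "t *\<^sub>R axis k 1"] that by simp
    moreover have "dist x (x + s *\<^sub>R axis i 1 + t *\<^sub>R axis k 1) = norm (s *\<^sub>R axis i (1::real) + t *\<^sub>R axis k 1)"
      by (subst dist_commute) (simp add: dist_norm add.assoc)
    ultimately show ?thesis using that by simp
  qed
  define \<phi> where "\<phi> s = D l (x + h *\<^sub>R axis k 1 + s *\<^sub>R axis i 1) - D l (x + s *\<^sub>R axis i 1)" for s
  define \<phi>' where "\<phi>' s = D (i # l) (x + h *\<^sub>R axis k 1 + s *\<^sub>R axis i 1) - D (i # l) (x + s *\<^sub>R axis i 1)" for s
  have "\<exists>z. z > 0 \<and> z < h \<and> \<phi> h - \<phi> 0 = (h - 0) * \<phi>' z"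
  proof (rule MVT2[OF h])
    fix s assume s: "0 \<le> s" "s \<le> h"
    have 1: "x + h *\<^sub>R axis k 1 + s *\<^sub>R axis i 1 \<in> U"
      using inU[of s h] s h ball by (auto simp: add_ac)
    have 2: "x + s *\<^sub>R axis i 1 \<in> U" using inU[of s 0] s h ball by auto
    show "DERIV \<phi> s :> \<phi>' s"
      unfolding \<phi>_def[abs_def] \<phi>'_def by (intro DERIV_diff part 1 2)
  qed
  then obtain s where s: "0 < s" "s < h" "\<phi> h - \<phi> 0 = h * \<phi>' s" by auto
  have "\<exists>z. z > 0 \<and> z < h \<and> D (i # l) (x + s *\<^sub>R axis i 1 + h *\<^sub>R axis k 1)
      - D (i # l) (x + s *\<^sub>R axis i 1 + 0 *\<^sub>R axis k 1)
      = (h - 0) * D (k # i # l) (x + s *\<^sub>R axis i 1 + z *\<^sub>R axis k 1)"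
    by (rule MVT2[OF h]) (use inU[of s] s h ball in \<open>auto intro!: part\<close>)
  then obtain t where t: "0 < t" "t < h" "\<phi>' s = h * D (k # i # l) (x + s *\<^sub>R axis i 1 + t *\<^sub>R axis k 1)"
    by (auto simp: \<phi>'_def add_ac)
  show ?thesis
    by (rule that[of "x + s *\<^sub>R axis i 1 + t *\<^sub>R axis k 1"])
      (use s t inU[of s t] in \<open>auto simp: \<phi>_def algebra_simps\<close>)
qed

text \<open>Both orders of differentiation represent the same second difference, at two points near
  \<open>x\<close>. Every member of a jet is differentiable, hence continuous at \<open>x\<close>,
  so the two values at \<open>x\<close> cannot differ.\<close>

lemma jet_on_symmetric:
  fixes D :: "2 list \<Rightarrow> real^2 \<Rightarrow> real"
  assumes D: "jet_on U D" and x: "x \<in> U"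
  shows "D (k # i # l) x = D (i # k # l) x"
proof (rule ccontr)
  assume ne: "D (k # i # l) x \<noteq> D (i # k # l) x"
  \<comment> \<open>Half of the supposed gap: two values within \<open>e\<close> of the respective
    limits cannot coincide.\<close>
  define e where "e = \<bar>D (k # i # l) x - D (i # k # l) x\<bar> / 2"
  have e: "e > 0" using ne by (simp add: e_def)
  have cont: "isCont (D m) x" for m
    using has_derivative_continuous[OF jet_onD[OF D x]] .
  obtain d1 where d1: "d1 > 0" "\<And>y. dist y x < d1 \<Longrightarrow> dist (D (k # i # l) y) (D (k # i # l) x) < e"
    using cont[of "k # i # l"] e unfolding continuous_at_eps_delta by blast
  obtain d2 where d2: "d2 > 0" "\<And>y. dist y x < d2 \<Longrightarrow> dist (D (i # k # l) y) (D (i # k # l) x) < e"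
    using cont[of "i # k # l"] e unfolding continuous_at_eps_delta by blast
  obtain d3 where d3: "d3 > 0" "ball x d3 \<subseteq> U"
    using D x openE unfolding jet_on_def by blast
  define h where "h = min d1 (min d2 d3) / 3"
  have h: "h > 0" "2 * h < d1" "2 * h < d2" "2 * h < d3" using d1 d2 d3 by (auto simp: h_def)
  have sub: "cball x (2 * h) \<subseteq> U" using d3 h by (auto simp: subset_iff)
  obtain y where y: "y \<in> cball x (2 * h)"
    "D l (x + h *\<^sub>R axis i 1 + h *\<^sub>R axis k 1) - D l (x + h *\<^sub>R axis i 1)
      - D l (x + h *\<^sub>R axis k 1) + D l x = h * h * D (k # i # l) y"
    using second_difference_mean_value[OF D h(1) sub] by blast
  obtain z where z: "z \<in> cball x (2 * h)"
    "D l (x + h *\<^sub>R axis k 1 + h *\<^sub>R axis i 1) - D l (x + h *\<^sub>R axis k 1)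
      - D l (x + h *\<^sub>R axis i 1) + D l x = h * h * D (i # k # l) z"
    using second_difference_mean_value[OF D h(1) sub] by blast
  have swap: "x + h *\<^sub>R axis k 1 + h *\<^sub>R axis i 1 = x + h *\<^sub>R axis i 1 + h *\<^sub>R axis k 1"
    by (simp add: add_ac)
  have "h * h * D (k # i # l) y = h * h * D (i # k # l) z"
    using y(2) z(2) unfolding swap by linarith
  hence "D (k # i # l) y = D (i # k # l) z" using h by simp
  moreover have "dist (D (k # i # l) y) (D (k # i # l) x) < e"
    using y h by (intro d1) (auto simp: dist_commute)
  moreover have "dist (D (i # k # l) z) (D (i # k # l) x) < e"
    using z h by (intro d2) (auto simp: dist_commute)
  ultimately show False
    using dist_triangle_half_r[of "D (i # k # l) z" "D (k # i # l) x" "2 * e" "D (i # k # l) x"]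
    by (simp add: e_def dist_real_def)
qed

text \<open>A normal form with all entries 1 ahead of all entries 2, so that an iterated partial
  derivative depends on two counts only.\<close>

definition mixed_partial :: "(2 list \<Rightarrow> 'b) \<Rightarrow> nat \<Rightarrow> nat \<Rightarrow> 'b" where
  "mixed_partial D i j = D (replicate i 1 @ replicate j 2)"

text \<open>A new 1 at the head keeps the normal form. A new 2 has to pass the \<open>i\<close>
  entries 1, which takes one exchange at the head in each step of an induction on
  \<open>i\<close>.\<close>

lemma mixed_partial_has_derivative:
  fixes D :: "2 list \<Rightarrow> real^2 \<Rightarrow> real"
  assumes D: "jet_on U D" and x: "x \<in> U"
  shows "(mixed_partial D i j has_derivative
    (\<lambda>v. v$1 * mixed_partial D (Suc i) j x + v$2 * mixed_partial D i (Suc j) x)) (at x)"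
proof -
  have "D (2 # replicate i 1 @ replicate j 2) x = D (replicate i 1 @ replicate (Suc j) 2) x"
    if "x \<in> U" for x
    using that
  proof (induction i arbitrary: x)
    case (Suc i)
    let ?l = "replicate i 1 @ replicate j 2" and ?m = "replicate i 1 @ replicate (Suc j) 2"
    \<comment> \<open>The induction hypothesis is an equality on all of the open set
      \<open>U\<close>, so it may be differentiated.\<close>
    have "(D ?m has_derivative (\<lambda>v. v$1 *\<^sub>R D (1 # 2 # ?l) x + v$2 *\<^sub>R D (2 # 2 # ?l) x)) (at x)"
      by (rule has_derivative_transform_within_open[OF jet_onD[OF D Suc.prems]])
        (use D Suc in \<open>auto simp: jet_on_def\<close>)
    from has_derivative_unique[OF this jet_onD[OF D Suc.prems]]
    have "D (1 # 2 # ?l) x = D (1 # ?m) x"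
      by (drule_tac x="axis 1 1" in fun_cong) (simp add: axis_def)
    thus ?case using jet_on_symmetric[OF D Suc.prems, of 2 1 ?l] by simp
  qed simp
  thus ?thesis using jet_onD[OF D x, of "replicate i 1 @ replicate j 2"] x
    by (simp add: mixed_partial_def)
qed

subsection \<open>Bivariate polynomials of bounded degree\<close>

lemma poly2_deg_leI: "(\<And>x. P x = (\<Sum>i\<le>N. \<Sum>j\<le>N - i. c i j * (x$1) ^ i * (x$2) ^ j)) \<Longrightarrow> poly2_deg_le N P"
  unfolding poly2_deg_le_def by blast

lemma poly2_deg_le_const: "poly2_deg_le N (\<lambda>_. a)"
proof (rule poly2_deg_leI)
  fix x :: "real^2"
  have "(\<Sum>j\<le>N - i. (if i = 0 \<and> j = 0 then a else 0) * (x$1) ^ i * (x$2) ^ j) = (if i = 0 then a else 0)" for i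
    by (auto simp: sum.delta if_distrib[of "\<lambda>c. c * _"] cong: if_cong)
  thus "a = (\<Sum>i\<le>N. \<Sum>j\<le>N - i. (if i = 0 \<and> j = 0 then a else 0) * (x$1) ^ i * (x$2) ^ j)"
    by simp
qed

lemma poly2_deg_le_add:
  assumes "poly2_deg_le N P" "poly2_deg_le N Q"
  shows "poly2_deg_le N (\<lambda>x. P x + Q x)"
proof -
  from assms obtain c c'
    where "\<forall>x. P x = (\<Sum>i\<le>N. \<Sum>j\<le>N - i. c i j * (x$1) ^ i * (x$2) ^ j)"
      and "\<forall>x. Q x = (\<Sum>i\<le>N. \<Sum>j\<le>N - i. c' i j * (x$1) ^ i * (x$2) ^ j)"
    unfolding poly2_deg_le_def by blast
  thus ?thesis
    by (intro poly2_deg_leI[where c="\<lambda>i j. c i j + c' i j"]) (simp add: algebra_simps sum.distrib)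
qed

lemma poly2_deg_le_cmult:
  assumes "poly2_deg_le N P"
  shows "poly2_deg_le N (\<lambda>x. a * P x)"
proof -
  from assms obtain c
    where "\<forall>x. P x = (\<Sum>i\<le>N. \<Sum>j\<le>N - i. c i j * (x$1) ^ i * (x$2) ^ j)"
    unfolding poly2_deg_le_def by blast
  thus ?thesis
    by (intro poly2_deg_leI[where c="\<lambda>i j. a * c i j"]) (simp add: sum_distrib_left mult.assoc)
qed

lemma poly2_deg_le_sum:
  "(\<And>a. a \<in> A \<Longrightarrow> poly2_deg_le N (P a)) \<Longrightarrow> poly2_deg_le N (\<lambda>x. \<Sum>a\<in>A. P a x)"
  by (induction A rule: infinite_finite_induct) (auto intro: poly2_deg_le_const poly2_deg_le_add)

lemma poly2_deg_le_Suc: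
  assumes "poly2_deg_le N P"
  shows "poly2_deg_le (Suc N) P"
proof -
  from assms obtain c
    where c: "\<forall>x. P x = (\<Sum>i\<le>N. \<Sum>j\<le>N - i. c i j * (x$1) ^ i * (x$2) ^ j)"
    unfolding poly2_deg_le_def by blast
  show ?thesis
  \<comment> \<open>Outside the triangle \<open>i + j \<le> N\<close> the given \<open>c\<close> is
    arbitrary and must be cut to zero before the triangle grows.\<close>
  proof (rule poly2_deg_leI[where c="\<lambda>i j. if i + j \<le> N then c i j else 0"])
    fix x :: "real^2"
    have "(\<Sum>j\<le>Suc N - i. (if i + j \<le> N then c i j else 0) * (x$1) ^ i * (x$2) ^ j)
        = (\<Sum>j\<le>N - i. c i j * (x$1) ^ i * (x$2) ^ j)" if "i \<le> N" for i
      using that by (intro sum.mono_neutral_cong_right) auto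
    thus "P x = (\<Sum>i\<le>Suc N. \<Sum>j\<le>Suc N - i. (if i + j \<le> N then c i j else 0) * (x$1) ^ i * (x$2) ^ j)"
      by (simp add: c)
  qed
qed

lemma poly2_deg_le_mono:
  assumes "poly2_deg_le N P" "N \<le> M"
  shows "poly2_deg_le M P"
  using assms(2,1) by (induction M rule: dec_induct) (auto intro: poly2_deg_le_Suc)

lemma poly2_deg_le_mult_nth:
  assumes "poly2_deg_le N P"
  shows "poly2_deg_le (Suc N) (\<lambda>x. x$k * P x)"
proof -
  from assms obtain c
    where c: "\<forall>x. P x = (\<Sum>i\<le>N. \<Sum>j\<le>N - i. c i j * (x$1) ^ i * (x$2) ^ j)"
    unfolding poly2_deg_le_def by blast
  consider "k = 1" | "k = 2" using exhaust_2 by blast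
  thus ?thesis
  proof cases
    case 1
    show ?thesis unfolding 1
      by (rule poly2_deg_leI[where c="\<lambda>i j. case i of 0 \<Rightarrow> 0 | Suc i \<Rightarrow> c i j"])
        (simp add: c sum.atMost_Suc_shift sum_distrib_left mult_ac del: sum.atMost_Suc)
  next
    case 2
    show ?thesis unfolding 2
    proof (rule poly2_deg_leI[where c="\<lambda>i j. case j of 0 \<Rightarrow> 0 | Suc j \<Rightarrow> c i j"])
      fix x :: "real^2"
      have "(\<Sum>j\<le>Suc N - i. (case j of 0 \<Rightarrow> 0 | Suc j \<Rightarrow> c i j) * (x$1) ^ i * (x$2) ^ j)
          = x$2 * (\<Sum>j\<le>N - i. c i j * (x$1) ^ i * (x$2) ^ j)" if "i \<le> N" for i
        using that by (simp add: Suc_diff_le sum.atMost_Suc_shift sum_distrib_left mult_ac del: sum.atMost_Suc)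
      thus "x$2 * P x = (\<Sum>i\<le>Suc N. \<Sum>j\<le>Suc N - i. (case j of 0 \<Rightarrow> 0 | Suc j \<Rightarrow> c i j) * (x$1) ^ i * (x$2) ^ j)"
        by (simp add: c sum_distrib_left)
    qed
  qed
qed

lemma poly2_deg_le_mult_linear:
  assumes "poly2_deg_le N P"
  shows "poly2_deg_le (Suc N) (\<lambda>x. (x$k - a) * P x)"
  using poly2_deg_le_add[OF poly2_deg_le_mult_nth[OF assms] poly2_deg_le_cmult[OF poly2_deg_le_Suc[OF assms]], of k "-a"]
  by (simp add: algebra_simps)

lemma poly2_deg_le_shifted_monomial:
  "poly2_deg_le (i + j) (\<lambda>x. (x$1 - a) ^ i * (x$2 - b) ^ j)"
proof (induction i)
  case 0
  show ?case
  proof (induction j)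
    case (Suc j)
    thus ?case using poly2_deg_le_mult_linear[OF Suc, of 2 b] by (simp add: mult_ac)
  qed (simp add: poly2_deg_le_const)
next
  case (Suc i)
  thus ?case using poly2_deg_le_mult_linear[OF Suc, of 1 a] by (simp add: mult_ac)
qed

subsection \<open>Dependence of the Taylor polynomial on its centre\<close>

text \<open>Here \<open>e\<close> stands for the partial derivatives, \<open>a\<close> and
  \<open>b\<close> for the scaled powers, \<open>a'\<close> and \<open>b'\<close> for the lowered
  powers, and \<open>p\<close>, \<open>q\<close> for the direction. Raising a derivative at order n
  cancels against lowering a power at order n + 1, so only the top order survives.\<close>

lemma taylor_coefficient_telescope:
  fixes e :: "nat \<Rightarrow> nat \<Rightarrow> 'a::comm_ring_1"
  assumes "a' 0 = 0" "b' 0 = 0" "\<And>i. a' (Suc i) = a i" "\<And>j. b' (Suc j) = b j"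
  shows "(\<Sum>n\<le>K. \<Sum>i\<le>n. (p * e (Suc i) (n - i) + q * e i (Suc (n - i))) * a i * b (n - i)
        - e i (n - i) * (p * a' i * b (n - i) + q * a i * b' (n - i)))
    = (\<Sum>i\<le>K. (p * e (Suc i) (K - i) + q * e i (Suc (K - i))) * a i * b (K - i))"
proof (induction K)
  case 0
  show ?case by (simp add: assms)
next
  case (Suc K)
  have "(\<Sum>i\<le>Suc K. e i (Suc K - i) * (p * a' i * b (Suc K - i)))
      = (\<Sum>i\<le>K. p * e (Suc i) (K - i) * a i * b (K - i))"
    by (subst sum.atMost_Suc_shift) (simp add: assms mult_ac)
  moreover have "(\<Sum>i\<le>Suc K. e i (Suc K - i) * (q * a i * b' (Suc K - i)))
      = (\<Sum>i\<le>K. q * e i (Suc (K - i)) * a i * b (K - i))"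
    by (simp add: assms Suc_diff_le mult_ac)
  \<comment> \<open>The subtracted part at order \<open>Suc K\<close> is exactly the remainder left
    at order \<open>K\<close>.\<close>
  ultimately have eq: "(\<Sum>i\<le>Suc K. e i (Suc K - i) * (p * a' i * b (Suc K - i) + q * a i * b' (Suc K - i)))
      = (\<Sum>i\<le>K. (p * e (Suc i) (K - i) + q * e i (Suc (K - i))) * a i * b (K - i))"
    by (simp only: distrib_left distrib_right sum.distrib)
  show ?case by (subst sum.atMost_Suc) (simp only: Suc.IH, simp only: sum_subtractf eq add_diff_eq add_diff_cancel_left')
qed

text \<open>The evaluation point \<open>y\<close> precedes the centre \<open>x\<close>, so that
  \<open>taylor_poly D K y\<close> is a function of the centre, the variable to be
  differentiated.\<close>

definition taylor_poly :: "(2 list \<Rightarrow> real^2 \<Rightarrow> real) \<Rightarrow> nat \<Rightarrow> real^2 \<Rightarrow> real^2 \<Rightarrow> real" where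
  "taylor_poly D K y x = (\<Sum>n\<le>K. \<Sum>i\<le>n. mixed_partial D i (n - i) x
     * ((y$1 - x$1) ^ i / fact i) * ((y$2 - x$2) ^ (n - i) / fact (n - i)))"

lemma taylor_poly_self: "taylor_poly D K x x = D [] x"
proof -
  have "(\<Sum>i\<le>n. mixed_partial D i (n - i) x * (0 ^ i / fact i) * (0 ^ (n - i) / fact (n - i)))
     = (if n = 0 then D [] x else 0)" for n
    by (auto simp: mixed_partial_def power_0_left intro!: sum.neutral)
  thus ?thesis by (simp add: taylor_poly_def)
qed

lemma poly2_deg_le_taylor_poly: "poly2_deg_le K (\<lambda>y. taylor_poly D K y x)"
  unfolding taylor_poly_def
proof (intro poly2_deg_le_sum)
  fix n i assume "n \<in> {..K}" "i \<in> {..n}"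
  hence "poly2_deg_le K (\<lambda>y. (y$1 - x$1) ^ i * (y$2 - x$2) ^ (n - i))"
    by (intro poly2_deg_le_mono[OF poly2_deg_le_shifted_monomial]) auto
  from poly2_deg_le_cmult[OF this, of "mixed_partial D i (n - i) x / fact i / fact (n - i)"]
  show "poly2_deg_le K (\<lambda>y. mixed_partial D i (n - i) x
     * ((y$1 - x$1) ^ i / fact i) * ((y$2 - x$2) ^ (n - i) / fact (n - i)))"
    by (simp add: mult_ac)
qed

text \<open>By the telescoping sum, the derivative in the centre involves only partial derivatives
  of order \<open>K + 1\<close>.\<close>

lemma taylor_poly_has_derivative:
  assumes D: "jet_on U D" and x: "x \<in> U"
  shows "(taylor_poly D K y has_derivative (\<lambda>v. \<Sum>i\<le>K.
      (v$1 * mixed_partial D (Suc i) (K - i) x + v$2 * mixed_partial D i (Suc (K - i)) x)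
      * ((y$1 - x$1) ^ i / fact i) * ((y$2 - x$2) ^ (K - i) / fact (K - i)))) (at x)"
proof -
  define p where "p k n z = (y$k - z$k) ^ n / fact n" for k n and z :: "real^2"
  \<comment> \<open>The lowered power, with value 0 at exponent 0 as the telescoping lemma demands;
    the minus sign in the next claim comes from differentiating in the centre.\<close>
  define p' where "p' k n z = (case n of 0 \<Rightarrow> 0 | Suc n \<Rightarrow> p k n z)" for k n and z :: "real^2"
  have p: "(p k n has_derivative (\<lambda>v. - (v$k * p' k n x))) (at x)" for k n
  proof (cases n)
    case 0
    thus ?thesis by (simp add: p_def[abs_def] p'_def)
  next
    case (Suc m)
    have "((\<lambda>z::real^2. y$k - z$k) has_derivative (\<lambda>v. 0 - v$k)) (at x)"
      by (intro has_derivative_diff has_derivative_const bounded_linear_imp_has_derivative bounded_linear_vec_nth)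
    from has_derivative_mult_right[OF has_derivative_power[OF this], of "1 / fact n" n]
    have "((\<lambda>z. (y$k - z$k) ^ n / fact n) has_derivative
       (\<lambda>v. of_nat n * (0 - v$k) * (y$k - x$k) ^ (n - 1) / fact n)) (at x)" by simp
    moreover have "of_nat n * (0 - t) * u ^ (n - 1) / fact n = - (t * (u ^ m / fact m))" for t u :: real
      by (simp add: Suc mult.assoc del: of_nat_Suc)
    ultimately show ?thesis by (simp add: p_def[abs_def] p'_def Suc)
  qed
  have "((\<lambda>z. mixed_partial D i j z * p 1 i z * p 2 j z) has_derivative
     (\<lambda>v. (v$1 * mixed_partial D (Suc i) j x + v$2 * mixed_partial D i (Suc j) x) * p 1 i x * p 2 j x
        - mixed_partial D i j x * (v$1 * p' 1 i x * p 2 j x + v$2 * p 1 i x * p' 2 j x))) (at x)" for i j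
    by (rule has_derivative_eq_rhs[OF has_derivative_mult[OF has_derivative_mult
        [OF mixed_partial_has_derivative[OF D x] p] p]])
      (simp add: algebra_simps fun_eq_iff)
  hence "((\<lambda>z. \<Sum>n\<le>K. \<Sum>i\<le>n. mixed_partial D i (n - i) z * p 1 i z * p 2 (n - i) z) has_derivative
     (\<lambda>v. \<Sum>n\<le>K. \<Sum>i\<le>n. (v$1 * mixed_partial D (Suc i) (n - i) x + v$2 * mixed_partial D i (Suc (n - i)) x)
          * p 1 i x * p 2 (n - i) x
        - mixed_partial D i (n - i) x * (v$1 * p' 1 i x * p 2 (n - i) x + v$2 * p 1 i x * p' 2 (n - i) x))) (at x)"
    by (intro has_derivative_sum)
  also have "(\<lambda>v::real^2. \<Sum>n\<le>K. \<Sum>i\<le>n. (v$1 * mixed_partial D (Suc i) (n - i) x + v$2 * mixed_partial D i (Suc (n - i)) x)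
          * p 1 i x * p 2 (n - i) x
        - mixed_partial D i (n - i) x * (v$1 * p' 1 i x * p 2 (n - i) x + v$2 * p 1 i x * p' 2 (n - i) x))
     = (\<lambda>v. \<Sum>i\<le>K. (v$1 * mixed_partial D (Suc i) (K - i) x + v$2 * mixed_partial D i (Suc (K - i)) x)
          * p 1 i x * p 2 (K - i) x)"
    by (intro ext taylor_coefficient_telescope[where e="\<lambda>i j. mixed_partial D i j x"
          and a="\<lambda>i. p 1 i x" and a'="\<lambda>i. p' 1 i x" and b="\<lambda>i. p 2 i x" and b'="\<lambda>i. p' 2 i x"])
      (simp_all add: p'_def)
  finally show ?thesis by (simp add: p_def taylor_poly_def[abs_def])
qed

subsection \<open>Fourier spectrum on the circles\<close>

text \<open>
  Frequencies in \<open>{-m, \<dots>, d - m - 1}\<close>: the bound \<open>d\<close> counts the admissible frequencies, so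
  \<open>d = 0\<close> means that the function vanishes on all circles.
\<close>

definition circle_spectrum ::
    "(real \<Rightarrow> real^2) \<Rightarrow> real \<Rightarrow> real \<Rightarrow> nat \<Rightarrow> (real^2 \<Rightarrow> complex) \<Rightarrow> bool" where
  "circle_spectrum \<gamma> r m d H \<longleftrightarrow> (\<forall>s. \<exists>p. deg_below d p \<and>
     (\<forall>\<theta>. cis (m * \<theta>) * H (circle_pt (\<gamma> s) r \<theta>) = poly p (cis \<theta>)))"

lemma cis_has_vector_derivative:
  "((\<lambda>\<theta>. cis (m * \<theta>)) has_vector_derivative \<i> * of_real m * cis (m * \<theta>)) (at \<theta>)"
  using has_derivative_cis[OF has_derivative_mult_right[OF has_derivative_ident], of m \<theta> UNIV]
  by (simp add: has_vector_derivative_def scaleR_conv_of_real mult_ac)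

text \<open>The polynomials \<open>p s\<close> are merely chosen for each \<open>s\<close>, with no
  regularity in \<open>s\<close>. Interpolation writes the function at any angle as a fixed linear
  combination of its values at finitely many angles, and this combination can be differentiated in
  \<open>s\<close>.\<close>

lemma circle_spectrum_deriv_along_curve:
  assumes H: "circle_spectrum \<gamma> r m d H"
    and h': "\<And>s \<theta>. ((\<lambda>s. H (circle_pt (\<gamma> s) r \<theta>)) has_vector_derivative h' s \<theta>) (at s)"
  shows "\<exists>q. deg_below d q \<and> (\<forall>\<theta>. cis (m * \<theta>) * h' s \<theta> = poly q (cis \<theta>))"
proof -
  obtain A :: "complex set" and l where fin: "finite A" and A: "\<And>a. a \<in> A \<Longrightarrow> norm a = 1"
    and l: "\<And>a. a \<in> A \<Longrightarrow> deg_below d (l a)"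
    and interp: "\<And>p z. deg_below d p \<Longrightarrow> poly p z = (\<Sum>a\<in>A. poly p a * poly (l a) z)"
    using unit_circle_interpolation[of d] by blast
  from H[unfolded circle_spectrum_def, THEN choice] obtain p where p: "\<And>s. deg_below d (p s)"
    and pH: "\<And>s \<theta>. cis (m * \<theta>) * H (circle_pt (\<gamma> s) r \<theta>) = poly (p s) (cis \<theta>)"
    by blast
  have cisA: "cis (Arg a) = a" if "a \<in> A" for a
    using rcis_cmod_Arg[of a] A[OF that] by (simp add: rcis_def)
  \<comment> \<open>The interpolating polynomial of the derivatives at the nodes.\<close>
  define q where "q = (\<Sum>a\<in>A. smult (cis (m * Arg a) * h' s (Arg a)) (l a))"
  have "cis (m * \<theta>) * h' s \<theta> = poly q (cis \<theta>)" for \<theta>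
  proof -
    have eq: "(\<lambda>s. cis (m * \<theta>) * H (circle_pt (\<gamma> s) r \<theta>))
        = (\<lambda>s. \<Sum>a\<in>A. cis (m * Arg a) * H (circle_pt (\<gamma> s) r (Arg a)) * poly (l a) (cis \<theta>))"
    proof
      fix s
      show "cis (m * \<theta>) * H (circle_pt (\<gamma> s) r \<theta>)
        = (\<Sum>a\<in>A. cis (m * Arg a) * H (circle_pt (\<gamma> s) r (Arg a)) * poly (l a) (cis \<theta>))"
        unfolding pH interp[OF p, of s "cis \<theta>"] by (intro sum.cong refl) (simp add: cisA)
    qed
    have "((\<lambda>s. \<Sum>a\<in>A. cis (m * Arg a) * H (circle_pt (\<gamma> s) r (Arg a)) * poly (l a) (cis \<theta>))
        has_vector_derivative (\<Sum>a\<in>A. cis (m * Arg a) * h' s (Arg a) * poly (l a) (cis \<theta>))) (at s)"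
      by (intro has_vector_derivative_sum
          has_vector_derivative_mult_left[OF has_vector_derivative_mult_right[OF h']])
    hence "((\<lambda>s. cis (m * \<theta>) * H (circle_pt (\<gamma> s) r \<theta>)) has_vector_derivative
        (\<Sum>a\<in>A. cis (m * Arg a) * h' s (Arg a) * poly (l a) (cis \<theta>))) (at s)"
      by (simp only: eq)
    from vector_derivative_unique_at[OF has_vector_derivative_mult_right[OF h'] this]
    show ?thesis by (simp add: q_def poly_sum)
  qed
  moreover have "deg_below d q"
    unfolding q_def by (intro deg_below_sum deg_below_smult l)
  ultimately show ?thesis by blast
qed

text \<open>With z = \<open>cis \<theta>\<close>, differentiating z^m h = p(z) gives z^m h' = i z
  p'(z) - i m p(z), and neither term raises the degree.\<close>

lemma laurent_deriv_along_circle: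
  assumes p: "deg_below d p" and pH: "\<And>\<theta>. cis (m * \<theta>) * h \<theta> = poly p (cis \<theta>)"
    and h': "\<And>\<theta>. (h has_vector_derivative h' \<theta>) (at \<theta>)"
  shows "\<exists>t. deg_below d t \<and> (\<forall>\<theta>. cis (m * \<theta>) * h' \<theta> = poly t (cis \<theta>))"
proof (intro exI conjI allI)
  let ?t = "smult \<i> (pCons 0 (pderiv p)) - smult (\<i> * of_real m) p"
  show "deg_below d ?t"
    by (intro deg_below_diff deg_below_smult deg_below_pCons_pderiv p)
  fix \<theta>
  have "((\<lambda>\<theta>. poly p (cis \<theta>)) has_vector_derivative (\<i> * cis \<theta>) * poly (pderiv p) (cis \<theta>)) (at \<theta>)"
    using field_vector_diff_chain_at[OF cis_has_vector_derivative[of 1 \<theta>, simplified] poly_DERIV[of p]]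
    by (simp add: o_def)
  hence "((\<lambda>\<theta>. cis (m * \<theta>) * h \<theta>) has_vector_derivative (\<i> * cis \<theta>) * poly (pderiv p) (cis \<theta>)) (at \<theta>)"
    by (simp only: pH)
  from vector_derivative_unique_at[OF has_vector_derivative_mult[OF cis_has_vector_derivative h'] this]
  have "cis (m * \<theta>) * h' \<theta> + \<i> * of_real m * (cis (m * \<theta>) * h \<theta>)
      = (\<i> * cis \<theta>) * poly (pderiv p) (cis \<theta>)"
    by (simp only: mult.assoc)
  thus "cis (m * \<theta>) * h' \<theta> = poly ?t (cis \<theta>)"
    unfolding pH by (simp add: algebra_simps)
qed

text \<open>Where \<open>u\<close> and \<open>v\<close> differ the quadratic vanishes. By continuity
  this happens on an open set of angles, so its derivative in the angle is 0 there; but that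
  derivative has modulus 2.\<close>

lemma eq_on_circle_if_eq_times_quadratic:
  fixes u v :: "real \<Rightarrow> complex"
  assumes g: "norm g = 1" and cont: "continuous_on UNIV u" "continuous_on UNIV v"
    and eq: "\<And>\<theta>. (g + cnj g * (cis \<theta>)\<^sup>2) * u \<theta> = (g + cnj g * (cis \<theta>)\<^sup>2) * v \<theta>"
  shows "u \<theta> = v \<theta>"
proof (rule ccontr)
  assume ne: "u \<theta> \<noteq> v \<theta>"
  let ?f = "\<lambda>\<theta>. g + cnj g * cis (2 * \<theta>)"
  let ?S = "{t. u t - v t \<noteq> 0}"
  have "open ?S" by (intro open_Collect_neq continuous_intros cont)
  moreover have "0 = ?f t" if "t \<in> ?S" for t
  proof -
    have "cis (2 * t) = (cis t)\<^sup>2" by (simp add: cis_mult power2_eq_square)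
    thus ?thesis using eq[of t] that by simp
  qed
  ultimately have "(?f has_vector_derivative 0) (at \<theta>)"
    using has_vector_derivative_transform_within_open[of "\<lambda>_. 0" 0 \<theta> ?S ?f] ne by simp
  moreover have "(?f has_vector_derivative 0 + cnj g * (\<i> * of_real 2 * cis (2 * \<theta>))) (at \<theta>)"
    by (intro has_vector_derivative_add has_vector_derivative_const
        has_vector_derivative_mult_right cis_has_vector_derivative)
  ultimately have "0 + cnj g * (\<i> * of_real 2 * cis (2 * \<theta>)) = 0"
    by (rule vector_derivative_unique_at[symmetric])
  thus False using g by (auto simp: cis_neq_zero)
qed

text \<open>At a zero of the quadratic on the circle, \<open>u\<close> is multiplied by 0, so
  \<open>a\<close> vanishes there and the quadratic divides it. Continuity of \<open>u\<close>
  settles the angles at which one cannot cancel.\<close>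

lemma divide_on_circle:
  assumes g: "norm g = 1" and a: "deg_below (Suc d) a"
    and u: "\<And>\<theta>. (g + cnj g * (cis \<theta>)\<^sup>2) * u \<theta> = poly a (cis \<theta>)"
    and cont: "continuous_on UNIV u"
  shows "\<exists>b. deg_below (d - 1) b \<and> (\<forall>\<theta>. u \<theta> = poly b (cis \<theta>))"
proof -
  have "poly a z = 0" if "g + cnj g * z\<^sup>2 = 0" "norm z = 1" for z
  proof -
    have "cis (Arg z) = z" using rcis_cmod_Arg[of z] that(2) by (simp add: rcis_def)
    thus ?thesis using u[of "Arg z"] that by simp
  qed
  then obtain b where b: "deg_below (d - 1) b" "\<And>z. poly a z = (g + cnj g * z\<^sup>2) * poly b z"
    using quadratic_factor[OF g a] by blast
  have "u \<theta> = poly b (cis \<theta>)" for \<theta>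
    by (rule eq_on_circle_if_eq_times_quadratic[OF g cont])
      (auto simp: u b(2) intro!: continuous_intros)
  with b(1) show ?thesis by blast
qed

text \<open>Each Wirtinger derivative loses one frequency: the first at the top of the window, the
  second at the bottom, whence \<open>m - 1\<close>. As \<open>m\<close> is real, this difference is
  never truncated.\<close>

lemma circle_spectrum_wirtinger:
  fixes D :: "2 list \<Rightarrow> real^2 \<Rightarrow> complex"
  assumes \<gamma>: "\<And>s. (\<gamma> has_vector_derivative \<gamma>' s) (at s)" and unit: "\<And>s. norm (\<gamma>' s) = 1"
    and r: "r > 0" and D: "jet_on U D" and U: "\<And>s \<theta>. circle_pt (\<gamma> s) r \<theta> \<in> U"
    and H: "circle_spectrum \<gamma> r m d (D [])"
  shows "circle_spectrum \<gamma> r m (d - 1) (\<lambda>x. 1/2 * D [1] x + (-\<i>/2) * D [2] x)"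
    and "circle_spectrum \<gamma> r (m - 1) (d - 1) (\<lambda>x. 1/2 * D [1] x + (\<i>/2) * D [2] x)"
proof -
  define X where "X s \<theta> = circle_pt (\<gamma> s) r \<theta>" for s \<theta>
  define u where "u s \<theta> = 1/2 * D [1] (X s \<theta>) + (-\<i>/2) * D [2] (X s \<theta>)" for s \<theta>
  define w where "w s \<theta> = 1/2 * D [1] (X s \<theta>) + (\<i>/2) * D [2] (X s \<theta>)" for s \<theta>
  define g where "g s = Complex (\<gamma>' s $ 1) (\<gamma>' s $ 2)" for s
  have g: "norm (g s) = 1" for s
    using unit[of s] by (simp add: g_def cmod_def norm_vec_def L2_set_def sum_2)
  have gg: "g s * cnj (g s) = 1" for s
    using g[of s] complex_norm_square[of "g s"] by simp
  have contX: "continuous_on UNIV (X s)" for s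
    unfolding X_def circle_pt_def by (intro continuous_intros)
  have contD: "continuous_on UNIV (\<lambda>\<theta>. D l (X s \<theta>))" for l s
  proof (rule continuous_on_compose2[OF _ contX])
    show "continuous_on U (D l)"
      using jet_onD[OF D] by (meson has_derivative_continuous continuous_at_imp_continuous_on)
  qed (auto simp: X_def U)
  have cont: "continuous_on UNIV (u s)" "continuous_on UNIV (w s)" for s
    unfolding u_def[abs_def] w_def[abs_def] by (intro continuous_intros contD)+
  have ds: "((\<lambda>s. D [] (circle_pt (\<gamma> s) r \<theta>)) has_vector_derivative g s * u s \<theta> + cnj (g s) * w s \<theta>) (at s)" for s \<theta>
  proof -
    have "(\<gamma>' s $ 1) *\<^sub>R D [1] (X s \<theta>) + (\<gamma>' s $ 2) *\<^sub>R D [2] (X s \<theta>)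
        = g s * u s \<theta> + cnj (g s) * w s \<theta>"
      by (simp add: g_def u_def w_def complex_eq_iff field_simps)
    thus ?thesis
      using has_vector_derivative_has_derivative_compose
        [OF circle_pt_centre_derivative[OF \<gamma>] jet_onD[OF D U[of s \<theta>], of "[]"]]
      by (simp add: X_def)
  qed
  have dt: "((\<lambda>\<theta>. D [] (circle_pt (\<gamma> s) r \<theta>)) has_vector_derivative
      \<i> * of_real r * (cis \<theta> * u s \<theta> - cnj (cis \<theta>) * w s \<theta>)) (at \<theta>)" for s \<theta>
  proof -
    have "(- (r * sin \<theta>)) *\<^sub>R D [1] (X s \<theta>) + (r * cos \<theta>) *\<^sub>R D [2] (X s \<theta>)
        = \<i> * of_real r * (cis \<theta> * u s \<theta> - cnj (cis \<theta>) * w s \<theta>)"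
      by (simp add: u_def w_def complex_eq_iff field_simps)
    thus ?thesis
      using has_vector_derivative_has_derivative_compose
        [OF circle_pt_angle_derivative jet_onD[OF D U[of s \<theta>], of "[]"]]
      by (simp add: X_def axis_def)
  qed
  have "(\<exists>b. deg_below (d - 1) b \<and> (\<forall>\<theta>. cis (m * \<theta>) * u s \<theta> = poly b (cis \<theta>))) \<and>
        (\<exists>b. deg_below (d - 1) b \<and> (\<forall>\<theta>. cis ((m - 1) * \<theta>) * w s \<theta> = poly b (cis \<theta>)))" for s
  proof -
    obtain q where q: "deg_below d q"
      "\<And>\<theta>. cis (m * \<theta>) * (g s * u s \<theta> + cnj (g s) * w s \<theta>) = poly q (cis \<theta>)"
      using circle_spectrum_deriv_along_curve[OF H ds, of s] by blast
    obtain p where p: "deg_below d p"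
      "\<And>\<theta>. cis (m * \<theta>) * D [] (circle_pt (\<gamma> s) r \<theta>) = poly p (cis \<theta>)"
      using H unfolding circle_spectrum_def by blast
    obtain t0 where t0: "deg_below d t0"
      "\<And>\<theta>. cis (m * \<theta>) * (\<i> * of_real r * (cis \<theta> * u s \<theta> - cnj (cis \<theta>) * w s \<theta>)) = poly t0 (cis \<theta>)"
      using laurent_deriv_along_circle[OF p dt] by blast
    \<comment> \<open>The constant factor ir of the angular derivative is divided out; this is where
      \<open>r > 0\<close> enters.\<close>
    define t where "t = smult (1 / (\<i> * of_real r)) t0"
    have t: "deg_below d t" using t0 by (simp add: t_def deg_below_smult)
    have pt: "poly t (cis \<theta>) = cis (m * \<theta>) * (cis \<theta> * u s \<theta> - cnj (cis \<theta>) * w s \<theta>)" for \<theta>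
      using r by (simp add: t_def flip: t0(2))
    have cc: "cis \<theta> * cnj (cis \<theta>) = 1" for \<theta> by (simp add: cis_cnj cis_mult)
    have cm: "cis ((m - 1) * \<theta>) = cis (m * \<theta>) * cnj (cis \<theta>)" for \<theta>
      by (simp add: cis_cnj cis_mult left_diff_distrib)
    \<comment> \<open>Elimination in the linear system for \<open>a\<close> and \<open>b\<close>,
      where \<open>z'\<close> stands for the conjugate of \<open>z = cis \<theta>\<close> and
      \<open>Z\<close> for \<open>cis (m * \<theta>)\<close>. The first identity removes
      \<open>b\<close>, the second \<open>a\<close>.\<close>
    have "(g s + cnj (g s) * z\<^sup>2) * (Z * a)
        = Z * (g s * a + cnj (g s) * b) + cnj (g s) * (z * (Z * (z * a - z' * b)))"
      "(g s + cnj (g s) * z\<^sup>2) * (Z * z' * b)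
        = z * (Z * (g s * a + cnj (g s) * b)) - g s * (Z * (z * a - z' * b))"
      if "z * z' = 1" for z z' Z a b
    proof -
      show "(g s + cnj (g s) * z\<^sup>2) * (Z * a)
        = Z * (g s * a + cnj (g s) * b) + cnj (g s) * (z * (Z * (z * a - z' * b)))"
        using that by algebra
      show "(g s + cnj (g s) * z\<^sup>2) * (Z * z' * b)
        = z * (Z * (g s * a + cnj (g s) * b)) - g s * (Z * (z * a - z' * b))"
        using that by algebra
    qed
    note id = this[OF cc]
    have "\<exists>b. deg_below (d - 1) b \<and> (\<forall>\<theta>. cis (m * \<theta>) * u s \<theta> = poly b (cis \<theta>))"
    proof (rule divide_on_circle[OF g])
      show "deg_below (Suc d) (q + smult (cnj (g s)) (pCons 0 t))"
        by (intro deg_below_add deg_below_smult deg_below_pCons deg_below_Suc q t)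
      show "(g s + cnj (g s) * (cis \<theta>)\<^sup>2) * (cis (m * \<theta>) * u s \<theta>)
          = poly (q + smult (cnj (g s)) (pCons 0 t)) (cis \<theta>)" for \<theta>
        by (simp only: id(1) poly_add poly_smult poly_pCons pt q(2)[symmetric] add_0)
      show "continuous_on UNIV (\<lambda>\<theta>. cis (m * \<theta>) * u s \<theta>)"
        by (intro continuous_intros cont)
    qed
    moreover have "\<exists>b. deg_below (d - 1) b \<and> (\<forall>\<theta>. cis (m * \<theta>) * cnj (cis \<theta>) * w s \<theta> = poly b (cis \<theta>))"
    proof (rule divide_on_circle[OF g])
      show "deg_below (Suc d) (pCons 0 q - smult (g s) t)"
        by (intro deg_below_diff deg_below_smult deg_below_pCons deg_below_Suc q t)
      show "(g s + cnj (g s) * (cis \<theta>)\<^sup>2) * (cis (m * \<theta>) * cnj (cis \<theta>) * w s \<theta>)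
          = poly (pCons 0 q - smult (g s) t) (cis \<theta>)" for \<theta>
        by (simp only: id(2) poly_diff poly_smult poly_pCons pt q(2)[symmetric] add_0)
      show "continuous_on UNIV (\<lambda>\<theta>. cis (m * \<theta>) * cnj (cis \<theta>) * w s \<theta>)"
        by (intro continuous_intros cont)
    qed
    ultimately show ?thesis by (simp only: cm)
  qed
  thus "circle_spectrum \<gamma> r m (d - 1) (\<lambda>x. 1/2 * D [1] x + (-\<i>/2) * D [2] x)"
    "circle_spectrum \<gamma> r (m - 1) (d - 1) (\<lambda>x. 1/2 * D [1] x + (\<i>/2) * D [2] x)"
    unfolding circle_spectrum_def u_def w_def X_def by blast+
qed

text \<open>Induction on the number of frequencies, for all jets and all \<open>m\<close> at once:
  the hypothesis is applied to the jets of both Wirtinger derivatives, whose sum and difference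
  recover the two partial derivatives.\<close>

lemma circle_spectrum_imp_derivs_vanish:
  fixes D :: "2 list \<Rightarrow> real^2 \<Rightarrow> complex"
  assumes \<gamma>: "\<And>s. (\<gamma> has_vector_derivative \<gamma>' s) (at s)" "\<And>s. norm (\<gamma>' s) = 1"
    and r: "r > 0" and U: "\<And>s \<theta>. circle_pt (\<gamma> s) r \<theta> \<in> U"
    and "jet_on U D" "circle_spectrum \<gamma> r m d (D [])" "length l = d"
  shows "D l (circle_pt (\<gamma> s) r \<theta>) = 0"
  using assms(5-)
proof (induction d arbitrary: D m l)
  case 0
  then obtain p where "deg_below 0 p" "cis (m * \<theta>) * D [] (circle_pt (\<gamma> s) r \<theta>) = poly p (cis \<theta>)"
    unfolding circle_spectrum_def by blast
  thus ?case using 0 by (simp add: deg_below_iff cis_neq_zero)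
next
  case (Suc d)
  let ?x = "circle_pt (\<gamma> s) r \<theta>"
  \<comment> \<open>The last entry is split off because it is the derivative taken first.\<close>
  obtain k i where l: "l = k @ [i]" "length k = d"
    using Suc.prems(3) by (metis length_append_singleton length_Suc_conv_rev)
  note W = circle_spectrum_wirtinger[OF \<gamma> r Suc.prems(1) U Suc.prems(2)]
  have u: "1/2 * D (k @ [1]) ?x + (-\<i>/2) * D (k @ [2]) ?x = 0"
    by (rule Suc.IH[OF jet_on_first_order[OF Suc.prems(1)]]) (use W(1) l in auto)
  have w: "1/2 * D (k @ [1]) ?x + (\<i>/2) * D (k @ [2]) ?x = 0"
    by (rule Suc.IH[OF jet_on_first_order[OF Suc.prems(1)]]) (use W(2) l in auto)
  have "D (k @ [1]) ?x = 0" using arg_cong2[OF u w, of "(+)"] by simp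
  moreover from this have "D (k @ [2]) ?x = 0" using w by simp
  ultimately show ?case using exhaust_2[of i] by (auto simp: l)
qed

section \<open>From polynomials on the circles to a global polynomial\<close>

text \<open>On the circle z times a coordinate is a quadratic polynomial in z. Hence z^N times a
  monomial of degree at most N is a polynomial in z of degree at most 2N.\<close>

lemma poly2_circle_spectrum:
  assumes "poly2_deg_le N P"
  shows "\<exists>p. deg_below (2 * N + 1) p \<and>
    (\<forall>\<theta>. cis (real N * \<theta>) * of_real (P (circle_pt a r \<theta>)) = poly p (cis \<theta>))"
proof -
  from assms obtain c where c: "\<And>x. P x = (\<Sum>i\<le>N. \<Sum>j\<le>N - i. c i j * (x$1) ^ i * (x$2) ^ j)"
    unfolding poly2_deg_le_def by blast
  \<comment> \<open>From x1 = a1 + (r/2)(z + 1/z) and x2 = a2 - (ir/2)(z - 1/z), multiplied by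
    z.\<close>
  define X where "X = [:of_real (r / 2), of_real (a$1), of_real (r / 2) :: complex:]"
  define Y where "Y = [:\<i> * of_real (r / 2), of_real (a$2), - \<i> * of_real (r / 2) :: complex:]"
  have X: "poly X (cis \<theta>) = cis \<theta> * of_real (circle_pt a r \<theta> $ 1)"
    and Y: "poly Y (cis \<theta>) = cis \<theta> * of_real (circle_pt a r \<theta> $ 2)" for \<theta>
  proof -
    define w where "w = cnj (cis \<theta>)"
    have w: "cis \<theta> * w = 1" by (simp add: w_def cis_cnj cis_mult)
    have x: "complex_of_real (circle_pt a r \<theta> $ 1) = of_real (a$1) + of_real (r / 2) * (cis \<theta> + w)"
      "complex_of_real (circle_pt a r \<theta> $ 2) = of_real (a$2) - \<i> * of_real (r / 2) * (cis \<theta> - w)"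
      by (simp_all add: w_def complex_eq_iff)
    have "poly X z = z * (of_real (a$1) + of_real (r / 2) * (z + w))"
      "poly Y z = z * (of_real (a$2) - \<i> * of_real (r / 2) * (z - w))" if "z * w = 1" for z w
    proof -
      have "c + z * (b + z * c) = z * (b + c * (z + w))"
        "c + z * (b + z * (- c)) = z * (b - c * (z - w))" for b c
        using that by algebra+
      thus "poly X z = z * (of_real (a$1) + of_real (r / 2) * (z + w))"
        "poly Y z = z * (of_real (a$2) - \<i> * of_real (r / 2) * (z - w))"
        by (simp_all only: X_def Y_def poly_pCons poly_0 mult_zero_right add_0_right mult_minus_left)
    qed
    from this[OF w] show "poly X (cis \<theta>) = cis \<theta> * of_real (circle_pt a r \<theta> $ 1)"
      "poly Y (cis \<theta>) = cis \<theta> * of_real (circle_pt a r \<theta> $ 2)"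
      by (simp_all only: x)
  qed
  have XY: "degree X \<le> 2" "degree Y \<le> 2" by (simp_all add: X_def Y_def)
  \<comment> \<open>The power \<open>N - i - j\<close> uses up the factors of z^N not absorbed by
    the \<open>i + j\<close> coordinates.\<close>
  define p where "p = (\<Sum>i\<le>N. \<Sum>j\<le>N - i. smult (of_real (c i j)) (monom 1 (N - i - j) * X ^ i * Y ^ j))"
  have "degree (monom 1 (N - i - j) * X ^ i * Y ^ j) \<le> 2 * N" if "i \<le> N" "j \<le> N - i" for i j
  proof -
    have "degree (monom 1 (N - i - j) * X ^ i * Y ^ j) \<le> (N - i - j) + 2 * i + 2 * j"
      by (intro order.trans[OF degree_mult_le] add_mono degree_monom_le order.trans[OF degree_power_le])
        (use XY in auto)
    thus ?thesis using that by simp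
  qed
  hence "deg_below (2 * N + 1) p"
    unfolding p_def by (intro deg_below_sum deg_below_smult) (simp add: deg_below_SucI)
  moreover have "cis (real N * \<theta>) * of_real (P (circle_pt a r \<theta>)) = poly p (cis \<theta>)" for \<theta>
  proof -
    let ?x = "circle_pt a r \<theta>" and ?z = "cis \<theta>"
    have "?z ^ N * of_real (c i j * (?x$1) ^ i * (?x$2) ^ j)
       = of_real (c i j) * (?z ^ (N - i - j) * (?z * of_real (?x$1)) ^ i * (?z * of_real (?x$2)) ^ j)"
      if "i \<le> N" "j \<le> N - i" for i j
    proof -
      have "?z ^ N = ?z ^ (N - i - j) * ?z ^ i * ?z ^ j"
        using that by (simp flip: power_add)
      thus ?thesis by (simp only: power_mult_distrib of_real_mult of_real_power) (simp only: mult_ac)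
    qed
    hence "?z ^ N * of_real (P ?x) = poly p ?z"
      unfolding c p_def of_real_sum sum_distrib_left poly_sum poly_smult poly_mult poly_power X Y poly_monom mult_1
      by (intro sum.cong refl) simp
    thus ?thesis by (simp add: Complex.DeMoivre)
  qed
  ultimately show ?thesis by blast
qed

text \<open>The evaluation point is kept fixed while the centre moves over the circles. The value
  does not change, and with the centre at the evaluation point it is \<open>D []\<close>
  there.\<close>

lemma derivs_vanish_imp_taylor:
  fixes \<gamma> :: "real \<Rightarrow> real^2"
  assumes \<gamma>: "\<And>s. \<gamma> differentiable at s" and D: "jet_on U D"
    and U: "\<And>s \<theta>. circle_pt (\<gamma> s) r \<theta> \<in> U"
    and zero: "\<And>l s \<theta>. length l = Suc K \<Longrightarrow> D l (circle_pt (\<gamma> s) r \<theta>) = 0"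
  shows "D [] (circle_pt (\<gamma> s) r \<theta>) = taylor_poly D K (circle_pt (\<gamma> s) r \<theta>) (circle_pt (\<gamma> 0) r 0)"
proof -
  let ?y = "circle_pt (\<gamma> s) r \<theta>"
  have "(taylor_poly D K ?y has_derivative (\<lambda>_. 0)) (at (circle_pt (\<gamma> s) r \<theta>))" for s \<theta>
    using taylor_poly_has_derivative[OF D U, of K ?y s \<theta>]
    by (simp add: mixed_partial_def zero)
  from has_derivative_zero_on_circles_const[OF \<gamma> this, of s \<theta> 0 0]
  show ?thesis by (simp add: taylor_poly_self)
qed

theorem theorem2p4:
  fixes \<gamma> :: "real \<Rightarrow> real^2" and L r :: real and F :: "real^2 \<Rightarrow> real" and N :: nat
  assumes curve: "arclength_simple_closed \<gamma> L"
    and r_pos: "r > 0"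
    and r_small: "ereal r < tubular_r0 \<gamma> L / 2"
    and F_smooth: "smooth_on_set (Omega_bar \<gamma> r) F"
    and circles: "\<forall>s. \<exists>P. poly2_deg_le N P \<and> (\<forall>x. dist x (\<gamma> s) = r \<longrightarrow> F x = P x)"
  shows "\<exists>P. poly2_deg_le (2 * N) P \<and> (\<forall>x\<in>Omega_bar \<gamma> r. F x = P x)"
proof -
  obtain E where E: "E 0 = \<gamma>" "\<And>k t. (E k has_vector_derivative E (Suc k) t) (at t)"
    using curve unfolding arclength_simple_closed_def smooth_curve_def by blast
  define \<gamma>' where "\<gamma>' s = vector_derivative \<gamma> (at s)" for s
  have \<gamma>': "(\<gamma> has_vector_derivative \<gamma>' s) (at s)" for s
    using E(2)[of 0 s] by (simp add: E(1) \<gamma>'_def vector_derivative_at)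
  have unit: "norm (\<gamma>' s) = 1" for s
    using curve by (simp add: arclength_simple_closed_def \<gamma>'_def)
  obtain U G where U: "Omega_bar \<gamma> r \<subseteq> U" "smooth_on_open U G"
    and G: "\<And>x. x \<in> Omega_bar \<gamma> r \<Longrightarrow> G x = F x"
    using F_smooth unfolding smooth_on_set_def by blast
  \<comment> \<open>The jet belongs to a smooth extension of \<open>F\<close> to an open set; only
    its values on the circles are compared with \<open>F\<close>.\<close>
  obtain D where D: "jet_on U D" "\<And>x. x \<in> U \<Longrightarrow> D [] x = G x"
    using smooth_on_openE[OF U(2)] by blast
  have circ: "circle_pt (\<gamma> s) r \<theta> \<in> Omega_bar \<gamma> r" for s \<theta>
    using dist_circle_pt[of r "\<gamma> s" \<theta>] r_pos by (auto simp: Omega_bar_def)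
  hence circU: "circle_pt (\<gamma> s) r \<theta> \<in> U" for s \<theta> using U by blast
  have DF: "D [] x = F x" if "x \<in> Omega_bar \<gamma> r" for x
    using that U D G by auto
  have spec: "circle_spectrum \<gamma> r (real N) (2 * N + 1) (\<lambda>x. complex_of_real (D [] x))"
    unfolding circle_spectrum_def
  proof
    fix s
    obtain P where P: "poly2_deg_le N P" "\<And>x. dist x (\<gamma> s) = r \<Longrightarrow> F x = P x"
      using circles by blast
    have "D [] (circle_pt (\<gamma> s) r \<theta>) = P (circle_pt (\<gamma> s) r \<theta>)" for \<theta>
      using DF[OF circ] P(2)[OF dist_circle_pt] r_pos by simp
    thus "\<exists>p. deg_below (2 * N + 1) p \<and>
        (\<forall>\<theta>. cis (real N * \<theta>) * of_real (D [] (circle_pt (\<gamma> s) r \<theta>)) = poly p (cis \<theta>))"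
      using poly2_circle_spectrum[OF P(1), of "\<gamma> s" r] by simp
  qed
  have zero: "D l (circle_pt (\<gamma> s) r \<theta>) = 0" if "length l = Suc (2 * N)" for l s \<theta>
    using circle_spectrum_imp_derivs_vanish[OF \<gamma>' unit r_pos circU jet_on_of_real[OF D(1)] spec, of l s \<theta>] that
    by simp
  show ?thesis
  proof (intro exI conjI ballI)
    \<comment> \<open>The witness is the Taylor polynomial of the extension, centred at one point of
      the circle about \<open>\<gamma> 0\<close>.\<close>
    show "poly2_deg_le (2 * N) (\<lambda>y. taylor_poly D (2 * N) y (circle_pt (\<gamma> 0) r 0))"
      by (rule poly2_deg_le_taylor_poly)
    fix x assume x: "x \<in> Omega_bar \<gamma> r"
    then obtain s where "dist x (\<gamma> s) = r" by (auto simp: Omega_bar_def)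
    then obtain \<theta> where x': "x = circle_pt (\<gamma> s) r \<theta>" by (rule circle_pt_exhaust)
    have "\<gamma> differentiable at s" for s
      using \<gamma>'[of s] by (simp add: differentiableI_vector)
    from derivs_vanish_imp_taylor[OF this D(1) circU zero]
    show "F x = taylor_poly D (2 * N) x (circle_pt (\<gamma> 0) r 0)"
      using DF[OF x] unfolding x' by simp
  qed
qed

end
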